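(* Let $d\ge 0$ and $r>d+1$ be integers, and let $z_1,z_2,z_3$ be positive integers with $z_1+z_2+z_3=d+3$. Then $$F=P_r\cap\Big(\bigcap_{i=1}^{z_1-1}H_i\Big)\cap\Big(\bigcap_{j=z_1+z_2}^{r}H_j\Big)\cap\Big(\bigcap_{k=z_1}^{r-z_3}\widehat H_k\Big)$$ is a face of the Kostka polytope $P_r$ of dimension at most $d$ with exactly $z_1z_2z_3$ vertices.
   Context: For a positive integer $r$, a partition with at most $r$ parts is written as a non-increasing $r$-tuple of nonnegative integers; $\mathrm{Par}_r(n)$ is the set of such tuples with entries summing to $n$. For $\lambda,\mu\in\mathrm{Par}_r(n)$, $\lambda$ dominates $\mu$ if $\sum_{i=1}^k\lambda_i\ge\sum_{i=1}^k\mu_i$ for all $k\le r$. The $r$-Kostka cone $\mathcal{K}_r\subseteq\mathbb{R}^{2r}$ is the convex hull of all points $(\lambda_1,\dots,\lambda_r,\mu_1,\dots,\mu_r)$ with $\lambda,\mu\in\mathrm{Par}_r(n)$ for some $n$ and $\lambda$ dominating $\mu$. The Kostka polytope $P_r$ is $\mathcal{K}_r\cap\{x:\sum_{i=1}^r(\lambda_i+\mu_i)=1\}$. In coordinates $(\lambda_1,\dots,\lambda_r,\mu_1,\dots,\mu_r)$ define the hyperplanes $H_i=\{\lambda_i=\lambda_{i+1}\}$ for $1\le i<r$, $H_r=\{\lambda_r=0\}$, and $\widehat H_i=\{\mu_i=\mu_{i+1}\}$ for $1\le i<r$. *)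

theory Defs
  imports "HOL-Analysis.Analysis"
begin

text \<open>
  The number \<open>r\<close> is \<open>CARD('r)\<close> for an index type \<open>'r\<close> of class \<open>{finite, linorder}\<close>, and
  \<open>\<real>\<^sup>2\<^sup>r\<close> is \<open>(real^'r) \<times> (real^'r)\<close> with coordinates \<open>(\<lambda>, \<mu>)\<close>.
  The index \<open>i \<in> {1..r}\<close> stands for the \<open>i\<close>-th smallest element of \<open>'r\<close>; outside that
  range \<open>idx\<close> is unspecified.
\<close>

definition idx :: "nat \<Rightarrow> 'r::{finite,linorder}" where
  "idx i = sorted_list_of_set (UNIV :: 'r set) ! (i - 1)"

definition coord :: "'a ^ ('r::{finite,linorder}) \<Rightarrow> nat \<Rightarrow> 'a" where
  "coord x i = x $ idx i"

lemma idx_strict_mono: "strict_mono_on {1..CARD('r)} (idx :: nat \<Rightarrow> 'r::{finite,linorder})"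
proof (rule strict_mono_onI)
  fix i j assume "i \<in> {1..CARD('r)}" "j \<in> {1..CARD('r)}" "i < j"
  then show "(idx i :: 'r) < idx j"
    unfolding idx_def
    by (intro sorted_wrt_nth_less[OF strict_sorted_list_of_set]) (auto simp: length_sorted_list_of_set)
qed

lemma bij_betw_idx: "bij_betw (idx :: nat \<Rightarrow> 'r::{finite,linorder}) {1..CARD('r)} UNIV"
proof -
  have inj: "inj_on (idx :: nat \<Rightarrow> 'r) {1..CARD('r)}"
    by (rule strict_mono_on_imp_inj_on[OF idx_strict_mono])
  then have "card ((idx :: nat \<Rightarrow> 'r) ` {1..CARD('r)}) = CARD('r)"
    by (simp add: card_image)
  then have "(idx :: nat \<Rightarrow> 'r) ` {1..CARD('r)} = UNIV"
    by (intro card_subset_eq) auto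
  with inj show ?thesis by (simp add: bij_betw_def)
qed

definition Par :: "nat \<Rightarrow> (nat ^ ('r::{finite,linorder})) set" where
  "Par n = {l. antimono (\<lambda>i. l $ i) \<and> (\<Sum>i\<in>UNIV. l $ i) = n}"

definition dominates ::
  "nat ^ ('r::{finite,linorder}) \<Rightarrow> nat ^ ('r::{finite,linorder}) \<Rightarrow> bool" where
  "dominates l m \<longleftrightarrow>
     (\<forall>k\<le>CARD('r). (\<Sum>i=1..k. coord l i) \<ge> (\<Sum>i=1..k. coord m i))"

definition real_vec :: "nat ^ 'r \<Rightarrow> real ^ 'r" where
  "real_vec l = (\<chi> i. real (l $ i))"

text \<open>
  The value \<open>n = 0\<close> is included; it contributes the apex \<open>(0, 0)\<close>, without which the convex
  hull below would not be a cone.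
\<close>

definition kostka_cone :: "((real ^ ('r::{finite,linorder})) \<times> (real ^ ('r::{finite,linorder}))) set" where
  "kostka_cone = convex hull
     {(real_vec l, real_vec m) | l m. \<exists>n. l \<in> Par n \<and> m \<in> Par n \<and> dominates l m}"

definition kostka_polytope :: "((real ^ ('r::{finite,linorder})) \<times> (real ^ ('r::{finite,linorder}))) set" where
  "kostka_polytope = kostka_cone \<inter> {(l, m). (\<Sum>i\<in>UNIV. l $ i + m $ i) = 1}"

text \<open>\<open>H i\<close> is meant for \<open>1 \<le> i \<le> r\<close> and \<open>H_hat i\<close> for \<open>1 \<le> i < r\<close>.\<close>

definition H :: "nat \<Rightarrow> ((real ^ ('r::{finite,linorder})) \<times> (real ^ ('r::{finite,linorder}))) set" where
  "H i = (if i < CARD('r) then {(l, m). coord l i = coord l (i + 1)}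
          else {(l, m). coord l CARD('r) = 0})"

definition H_hat :: "nat \<Rightarrow> ((real ^ ('r::{finite,linorder})) \<times> (real ^ ('r::{finite,linorder}))) set" where
  "H_hat i = {(l, m). coord m i = coord m (i + 1)}"

end

theory Submission imports Defs begin

text \<open>
  Let \<open>\<omega>\<^sub>m\<close> be the indicator vector of the first \<open>m\<close> coordinates, so that the coefficients of a vector
  in the \<open>\<omega>\<^sub>m\<close> are its successive differences. On the face, \<open>\<lambda> = \<Sum>\<^sub>j a\<^sub>j \<omega>\<^sub>j\<close> and
  \<open>\<mu> = \<Sum>\<^sub>i b\<^sub>i \<omega>\<^sub>i + \<Sum>\<^sub>k c\<^sub>k \<omega>\<^sub>k\<close> with \<open>i < j < k\<close> ranging over sets \<open>I\<close>, \<open>J\<close>, \<open>K\<close> of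
  sizes \<open>z\<^sub>1\<close>, \<open>z\<^sub>2\<close>, \<open>z\<^sub>3\<close>, where \<open>\<omega>\<^sub>0 = 0\<close> gets the coefficient \<open>b\<^sub>0 = \<lambda>\<^sub>1 - \<mu>\<^sub>1\<close>. All these
  coefficients are nonnegative on the cone, and they satisfy \<open>\<Sum> a\<^sub>j = \<Sum> b\<^sub>i + \<Sum> c\<^sub>k\<close> and
  \<open>\<Sum> j a\<^sub>j = \<Sum> i b\<^sub>i + \<Sum> k c\<^sub>k\<close>. The elementary solution on the support \<open>(i, j, k)\<close> is
  \<open>a\<^sub>j = k - i\<close>, \<open>b\<^sub>i = k - j\<close>, \<open>c\<^sub>k = j - i\<close>, and any solution is the combination of these with weights
  \<open>a\<^sub>j b\<^sub>i c\<^sub>k / D\<close>, where \<open>D = \<Sum> b\<^sub>i \<cdot> \<Sum> k c\<^sub>k - \<Sum> i b\<^sub>i \<cdot> \<Sum> c\<^sub>k\<close>.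
  Each elementary solution is a vertex: the sum of the coefficients off its support vanishes
  there and is positive at every other elementary solution.
\<close>

section \<open>Fundamental weights, gaps and elementary solutions\<close>

text \<open>The entry type is left open so that the same vectors serve both for integer partitions
  and for real points.\<close>

definition omega :: "nat \<Rightarrow> 'a::zero_neq_one ^ ('r::{finite,linorder})" where
  "omega m = (\<chi> x. of_bool (x \<in> idx ` {1..m}))"

text \<open>The coordinate after the last one counts as 0. The gap of \<lambda> at n thus vanishes
  exactly on \<open>H n\<close>, also for n = \<open>CARD('r)\<close>.\<close>

definition gap :: "real ^ ('r::{finite,linorder}) \<Rightarrow> nat \<Rightarrow> real" where
  "gap x n = coord x n - (if n < CARD('r) then coord x (n + 1) else 0)"

text \<open>The value at \<open>0\<close> is the slack of the dominance inequality \<open>\<mu>\<^sub>1 \<le> \<lambda>\<^sub>1\<close>.\<close>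

definition mu_gap :: "(real ^ ('r::{finite,linorder})) \<times> (real, 'r) vec \<Rightarrow> nat \<Rightarrow> real" where
  "mu_gap x n = (if n = 0 then coord (fst x) 1 - coord (snd x) 1 else gap (snd x) n)"

definition vec_total :: "real ^ ('r::{finite,linorder}) \<Rightarrow> real" where
  "vec_total x = (\<Sum>i\<in>UNIV. x $ i)"

definition kostka_ray :: "nat \<Rightarrow> nat \<Rightarrow> nat \<Rightarrow> (real ^ ('r::{finite,linorder})) \<times> (real, 'r) vec" where
  "kostka_ray i j k = ((real k - real i) *\<^sub>R omega j,
     (real k - real j) *\<^sub>R omega i + (real j - real i) *\<^sub>R omega k)"

text \<open>Both components of the ray have coordinate sum j (k - i), so the factor brings the total
  of all coordinates to 1.\<close>

definition kostka_vertex :: "nat \<Rightarrow> nat \<Rightarrow> nat \<Rightarrow> (real ^ ('r::{finite,linorder})) \<times> (real, 'r) vec" where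
  "kostka_vertex i j k = inverse (2 * real j * (real k - real i)) *\<^sub>R kostka_ray i j k"

section \<open>Expansion of vectors in the fundamental weights\<close>

lemma idx_surj:
  obtains n where "n \<in> {1..CARD('r)}" "s = (idx n :: 'r::{finite,linorder})"
proof -
  have "s \<in> (idx :: nat \<Rightarrow> 'r) ` {1..CARD('r)}"
    using bij_betw_imp_surj_on[OF bij_betw_idx] by blast
  then show thesis using that by blast
qed

lemma idx_mem_iff:
  assumes "n \<in> {1..CARD('r)}" "m \<le> CARD('r)"
  shows "(idx n :: 'r::{finite,linorder}) \<in> idx ` {1..m} \<longleftrightarrow> n \<le> m"
proof
  assume "(idx n :: 'r) \<in> idx ` {1..m}"
  then obtain p where p: "p \<in> {1..m}" "(idx n :: 'r) = idx p" by auto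
  have "n = p"
    by (rule inj_onD[OF bij_betw_imp_inj_on[OF bij_betw_idx] p(2)]) (use assms p in auto)
  with p show "n \<le> m" by simp
qed (use assms in auto)

lemma coord_omega:
  assumes "n \<in> {1..CARD('r)}" "m \<le> CARD('r)"
  shows "coord (omega m :: 'a::zero_neq_one ^ ('r::{finite,linorder})) n = of_bool (n \<le> m)"
  using idx_mem_iff[OF assms] by (simp add: coord_def omega_def)

lemma omega_0: "omega 0 = 0"
  by (simp add: omega_def vec_eq_iff)

lemma coord_linear: "linear (\<lambda>x. coord (x :: real ^ ('r::{finite,linorder})) n)"
  by (rule linearI) (simp_all add: coord_def)

lemma gap_linear: "linear (\<lambda>x. gap (x :: real ^ ('r::{finite,linorder})) n)"
  by (rule linearI) (simp_all add: gap_def coord_def algebra_simps)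

lemma mu_gap_linear: "linear (\<lambda>x :: (real ^ ('r::{finite,linorder})) \<times> (real, 'r) vec. mu_gap x n)"
  by (rule linearI) (simp_all add: mu_gap_def gap_def coord_def algebra_simps)

lemma total_linear: "linear (vec_total :: real ^ ('r::{finite,linorder}) \<Rightarrow> real)"
  by (rule linearI) (simp_all add: vec_total_def sum.distrib sum_distrib_left)

lemma sum_coord:
  "(\<Sum>i\<in>UNIV. (x :: 'a::comm_monoid_add ^ ('r::{finite,linorder})) $ i) = (\<Sum>n=1..CARD('r). coord x n)"
  unfolding coord_def by (rule sum.reindex_bij_betw[OF bij_betw_idx, symmetric])

lemma coord_eqI:
  assumes "\<And>n. n \<in> {1..CARD('r)} \<Longrightarrow> coord x n = coord y n"
  shows "x = (y :: 'a ^ ('r::{finite,linorder}))"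
proof (rule vec_eq_iff[THEN iffD2], rule allI)
  fix s :: 'r
  obtain n where "n \<in> {1..CARD('r)}" "s = idx n" by (rule idx_surj)
  with assms[of n] show "x $ s = y $ s" by (simp add: coord_def)
qed

lemma sum_of_bool_le:
  "(\<Sum>n=1..p. of_bool (n \<le> m)) = (of_nat (min p m) :: 'a::semiring_1)"
proof -
  have "(\<Sum>n=1..p. of_bool (n \<le> m) :: 'a) = of_nat (card ({1..p} \<inter> {n. n \<le> m}))"
    by simp
  also have "{1..p} \<inter> {n. n \<le> m} = {1..min p m}" by auto
  finally show ?thesis by simp
qed

lemma total_omega:
  assumes "m \<le> CARD('r)"
  shows "vec_total (omega m :: real ^ ('r::{finite,linorder})) = real m"
proof -
  have "vec_total (omega m :: (real, 'r) vec) = (\<Sum>n=1..CARD('r). of_bool (n \<le> m))"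
    unfolding vec_total_def sum_coord using assms by (intro sum.cong) (auto simp: coord_omega)
  also have "\<dots> = real m" using sum_of_bool_le[of m "CARD('r)", where 'a = real] assms by simp
  finally show ?thesis .
qed

lemma gap_omega:
  assumes "n \<in> {1..CARD('r)}" "m \<le> CARD('r)"
  shows "gap (omega m :: real ^ ('r::{finite,linorder})) n = of_bool (n = m)"
  using assms by (auto simp: gap_def coord_omega)

lemma sum_gap:
  assumes "n \<in> {1..CARD('r)}"
  shows "(\<Sum>m=n..CARD('r). gap x m) = coord (x :: real ^ ('r::{finite,linorder})) n"
proof -
  \<comment> \<open>\<open>L\<close> continues the coordinates by 0, so that the sum telescopes up
    to and including the last index.\<close>
  define L where "L m = (if m \<le> CARD('r) then coord x m else 0)" for m
  have "(\<Sum>m=n..CARD('r). gap x m) = (\<Sum>m=n..CARD('r). - (L (Suc m) - L m))"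
    by (intro sum.cong) (auto simp: gap_def L_def)
  also have "\<dots> = - (L (Suc (CARD('r))) - L n)"
    unfolding sum_negf by (subst sum_Suc_diff) (use assms in auto)
  also have "\<dots> = coord x n" using assms by (simp add: L_def)
  finally show ?thesis .
qed

text \<open>Summation by parts: \<open>omega m\<close> contributes to coordinate n exactly when n
  \<le> m, and the gaps from n on telescope to that coordinate.\<close>

lemma omega_expansion:
  "(x :: real ^ ('r::{finite,linorder})) = (\<Sum>m=1..CARD('r). gap x m *\<^sub>R omega m)"
proof (rule coord_eqI)
  fix n assume n: "n \<in> {1..CARD('r)}"
  have "coord (\<Sum>m=1..CARD('r). gap x m *\<^sub>R (omega m :: (real, 'r) vec)) n = (\<Sum>m=1..CARD('r). gap x m * of_bool (n \<le> m))"
    unfolding linear_sum[OF coord_linear] linear_cmul[OF coord_linear] real_scaleR_def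
    by (rule sum.cong[OF refl], subst coord_omega) (use n in auto)
  also have "\<dots> = (\<Sum>m=n..CARD('r). gap x m)"
    using n by (intro sum.mono_neutral_cong_right) auto
  also have "\<dots> = coord x n" by (rule sum_gap[OF n])
  finally show "coord x n = coord (\<Sum>m=1..CARD('r). gap x m *\<^sub>R (omega m :: (real, 'r) vec)) n" ..
qed

text \<open>For m \<ge> 1 the vector \<open>omega m\<close> has first coordinate 1 and total m, so
  both scalar identities are images of the expansion under linear functionals. They become the
  balance equations on the face.\<close>

lemma omega_expansion_on:
  assumes "S \<subseteq> {1..CARD('r)}" "\<forall>m\<in>{1..CARD('r)} - S. gap x m = 0"
  shows "(x :: real ^ ('r::{finite,linorder})) = (\<Sum>m\<in>S. gap x m *\<^sub>R omega m)"
    and "coord x 1 = (\<Sum>m\<in>S. gap x m)"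
    and "vec_total x = (\<Sum>m\<in>S. gap x m * real m)"
proof -
  have "(\<Sum>m\<in>S. gap x m *\<^sub>R (omega m :: (real, 'r) vec)) = (\<Sum>m=1..CARD('r). gap x m *\<^sub>R omega m)"
    using assms by (intro sum.mono_neutral_left) auto
  then show 1: "x = (\<Sum>m\<in>S. gap x m *\<^sub>R omega m)" using omega_expansion[of x] by simp
  have "coord x 1 = (\<Sum>m=1..CARD('r). gap x m)"
    by (rule sum_gap[symmetric]) (simp add: Suc_leI)
  also have "\<dots> = (\<Sum>m\<in>S. gap x m)"
    using assms by (intro sum.mono_neutral_right) auto
  finally show "coord x 1 = (\<Sum>m\<in>S. gap x m)" .
  have "vec_total x = vec_total (\<Sum>m\<in>S. gap x m *\<^sub>R (omega m :: (real, 'r) vec))" using 1 by simp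
  also have "\<dots> = (\<Sum>m\<in>S. gap x m * real m)"
    using assms(1) by (auto simp: linear_sum[OF total_linear] linear_cmul[OF total_linear] total_omega
      intro!: sum.cong)
  finally show "vec_total x = (\<Sum>m\<in>S. gap x m * real m)" .
qed

section \<open>Linear inequalities on the cone\<close>

lemma idx_le:
  assumes "n \<in> {1..CARD('r)}" "m \<in> {1..CARD('r)}"
  shows "(idx n :: 'r::{finite,linorder}) \<le> idx m \<longleftrightarrow> n \<le> m"
  using strict_mono_on_less_eq[OF idx_strict_mono assms] .

lemma gap_real_vec_nonneg:
  fixes l :: "nat ^ ('r::{finite,linorder})"
  assumes "l \<in> Par N" "n \<in> {1..CARD('r)}"
  shows "gap (real_vec l) n \<ge> 0"
proof (cases "n < CARD('r)")
  case True
  then have "(idx n :: 'r) \<le> idx (n + 1)" using assms(2) by (subst idx_le) auto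
  then show ?thesis using assms(1) True by (auto simp: Par_def gap_def coord_def real_vec_def antimono_def)
qed (auto simp: gap_def coord_def real_vec_def)

text \<open>All three conditions are linear and hence define a convex set, so it suffices to check
  the generating pairs: monotonicity gives the gaps, dominance at k = 1 gives the value at 0, and
  both partitions have the same size.\<close>

lemma kostka_cone_inequalities:
  fixes x :: "(real ^ ('r::{finite,linorder})) \<times> (real, 'r) vec"
  assumes "x \<in> kostka_cone"
  shows "n \<in> {1..CARD('r)} \<Longrightarrow> gap (fst x) n \<ge> 0"
    and "n \<le> CARD('r) \<Longrightarrow> mu_gap x n \<ge> 0"
    and "vec_total (fst x) = vec_total (snd x)"
proof -
  define C :: "((real, 'r) vec \<times> (real, 'r) vec) set" where
    "C = {x. (\<forall>n\<in>{1..CARD('r)}. gap (fst x) n \<ge> 0) \<and> (\<forall>n\<le>CARD('r). mu_gap x n \<ge> 0)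
       \<and> vec_total (fst x) = vec_total (snd x)}"
  have "convex C"
    unfolding C_def convex_def
    by (auto simp: linear_add[OF gap_linear] linear_cmul[OF gap_linear] linear_add[OF total_linear]
      linear_cmul[OF total_linear] linear_add[OF mu_gap_linear] linear_cmul[OF mu_gap_linear]
      simp del: atLeastAtMost_iff)
  moreover have "(real_vec l, real_vec m) \<in> C" if "l \<in> Par N" "m \<in> Par N" "dominates l m" for l m N
  proof -
    have "mu_gap (real_vec l, real_vec m) n \<ge> 0" if "n \<le> CARD('r)" for n
    proof (cases "n = 0")
      case True
      have "1 \<le> CARD('r)" by (simp add: Suc_leI)
      then have "(\<Sum>i=1..1. coord l i) \<ge> (\<Sum>i=1..1. coord m i)"
        using \<open>dominates l m\<close> unfolding dominates_def by blast
      then show ?thesis using True by (simp add: mu_gap_def coord_def real_vec_def)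
    next
      case False
      then show ?thesis using gap_real_vec_nonneg[OF \<open>m \<in> Par N\<close>, of n] that by (simp add: mu_gap_def)
    qed
    moreover have "vec_total (real_vec l) = vec_total (real_vec m)"
      using that(1,2) by (simp add: vec_total_def real_vec_def Par_def flip: of_nat_sum)
    ultimately show ?thesis using gap_real_vec_nonneg[OF \<open>l \<in> Par N\<close>] by (simp add: C_def)
  qed
  ultimately have "kostka_cone \<subseteq> C"
    unfolding kostka_cone_def by (intro hull_minimal) auto
  with assms have "x \<in> C" by auto
  then show "n \<in> {1..CARD('r)} \<Longrightarrow> gap (fst x) n \<ge> 0"
    and "n \<le> CARD('r) \<Longrightarrow> mu_gap x n \<ge> 0"
    and "vec_total (fst x) = vec_total (snd x)" by (auto simp: C_def)
qed

section \<open>Elementary solutions as points of the polytope\<close>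

lemma omega_antimono: 
  assumes "x \<le> y" "m \<le> CARD('r)"
  shows "(omega m :: nat ^ ('r::{finite,linorder})) $ y \<le> omega m $ x"
proof -
  obtain p where p: "p \<in> {1..CARD('r)}" "x = idx p" by (rule idx_surj)
  obtain q where q: "q \<in> {1..CARD('r)}" "y = idx q" by (rule idx_surj)
  have "p \<le> q" using assms(1) idx_le[OF p(1) q(1)] p q by simp
  then show ?thesis
    unfolding omega_def vec_lambda_beta p(2) q(2) idx_mem_iff[OF p(1) assms(2)] idx_mem_iff[OF q(1) assms(2)]
    by simp
qed

text \<open>The ray is itself a pair of partitions. As j is the mean of i and k with weights k - j
  and j - i, dominance at p is Jensen's inequality for the concave function sending n to
  \<open>min p n\<close>.\<close>

lemma kostka_ray_mem_cone:
  assumes "i < j" "j < k" "k \<le> CARD('r)"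
  shows "(kostka_ray i j k :: (real ^ ('r::{finite,linorder})) \<times> _) \<in> kostka_cone"
proof -
  \<comment> \<open>Expressing j and k through i, s and t removes truncated subtraction.\<close>
  define s t where "s = j - i" and "t = k - j"
  have j: "j = i + s" and k: "k = i + s + t" using assms by (auto simp: s_def t_def)
  define l m :: "(nat, 'r) vec" where "l = (\<chi> x. (s + t) * omega j $ x)"
    and "m = (\<chi> x. t * omega i $ x + s * omega k $ x)"
  have part_l: "(\<Sum>n=1..p. coord l n) = (s + t) * min p j" if "p \<le> CARD('r)" for p
  proof -
    have "(\<Sum>n=1..p. coord l n) = (\<Sum>n=1..p. (s + t) * of_bool (n \<le> j))"
      using that assms coord_omega[where 'r = 'r and 'a = nat]
      by (intro sum.cong) (auto simp: l_def coord_def)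
    then show ?thesis using sum_of_bool_le[where 'a = nat] by (simp flip: sum_distrib_left)
  qed
  have part_m: "(\<Sum>n=1..p. coord m n) = t * min p i + s * min p k" if "p \<le> CARD('r)" for p
  proof -
    have "(\<Sum>n=1..p. coord m n) = (\<Sum>n=1..p. t * of_bool (n \<le> i) + s * of_bool (n \<le> k))"
      using that assms coord_omega[where 'r = 'r and 'a = nat]
      by (intro sum.cong) (auto simp: m_def coord_def)
    then show ?thesis using sum_of_bool_le[where 'a = nat] by (simp add: sum.distrib flip: sum_distrib_left)
  qed
  have "l \<in> Par ((s + t) * j)" "m \<in> Par ((s + t) * j)"
    using part_l[of "CARD('r)"] part_m[of "CARD('r)"] assms
    by (auto simp: Par_def sum_coord antimono_def l_def m_def j k omega_antimono algebra_simps
      intro!: add_mono mult_left_mono)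
  moreover have "t * min p i + s * min p k \<le> (s + t) * min p j" for p
  proof -
    consider "p \<le> i" | "i \<le> p" "p \<le> j" | "j \<le> p" by linarith
    then show ?thesis
    proof cases
      case 2
      then have "t * i \<le> t * p" by simp
      with 2 show ?thesis by (simp add: min_def j k algebra_simps)
    next
      case 3
      have "s * min p k \<le> s * k" by simp
      with 3 show ?thesis by (simp add: j k algebra_simps)
    qed (simp add: j k algebra_simps)
  qed
  then have "dominates l m" unfolding dominates_def by (metis part_l part_m)
  moreover have "kostka_ray i j k = (real_vec l, real_vec m)"
    by (auto simp: kostka_ray_def real_vec_def l_def m_def vec_eq_iff omega_def j k)
  ultimately show ?thesis unfolding kostka_cone_def by (intro hull_inc) blast
qed

text \<open>The cone is given as a convex hull, so scaling a point down means averaging it with the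
  apex.\<close>

lemma zero_mem_kostka_cone: "(0 :: (real ^ ('r::{finite,linorder})) \<times> (real, 'r) vec) \<in> kostka_cone"
proof -
  have "(0 :: (nat, 'r) vec) \<in> Par 0" "dominates (0 :: (nat, 'r) vec) 0"
    by (simp_all add: Par_def dominates_def antimono_def)
  moreover have "(0 :: (real, 'r) vec \<times> (real, 'r) vec) = (real_vec 0, real_vec 0)"
    by (simp add: real_vec_def vec_eq_iff prod_eq_iff)
  ultimately show ?thesis unfolding kostka_cone_def by (intro hull_inc) blast
qed

lemma total_kostka_vertex:
  assumes "i < j" "j < k" "k \<le> CARD('r)"
  defines "v \<equiv> kostka_vertex i j k :: (real ^ ('r::{finite,linorder})) \<times> (real, 'r) vec"
  shows "vec_total (fst v) = 1 / 2" "vec_total (snd v) = 1 / 2"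
proof -
  have "fst v = inverse (2 * real j * (real k - real i)) *\<^sub>R (real k - real i) *\<^sub>R omega j"
    "snd v = inverse (2 * real j * (real k - real i)) *\<^sub>R
      ((real k - real j) *\<^sub>R omega i + (real j - real i) *\<^sub>R omega k)"
    by (simp_all add: v_def kostka_vertex_def kostka_ray_def)
  then have "vec_total (fst v) = inverse (2 * real j * (real k - real i)) * ((real k - real i) * real j)"
    "vec_total (snd v) = inverse (2 * real j * (real k - real i)) *
      ((real k - real j) * real i + (real j - real i) * real k)"
    using assms(1-3) by (simp_all only: linear_add[OF total_linear] linear_cmul[OF total_linear]
      total_omega real_scaleR_def)
  moreover have "(real k - real j) * real i + (real j - real i) * real k = (real k - real i) * real j"
    by algebra
  ultimately show "vec_total (fst v) = 1 / 2" "vec_total (snd v) = 1 / 2"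
    using assms(1,2) by (simp_all add: divide_simps)
qed

lemma mem_kostka_polytope:
  "x \<in> kostka_polytope \<longleftrightarrow> x \<in> kostka_cone \<and> vec_total (fst x) + vec_total (snd x) = 1"
  by (auto simp: kostka_polytope_def vec_total_def sum.distrib)

lemma kostka_vertex_mem_polytope:
  assumes "i < j" "j < k" "k \<le> CARD('r)"
  shows "(kostka_vertex i j k :: (real ^ ('r::{finite,linorder})) \<times> _) \<in> kostka_polytope"
proof -
  define N where "N = 2 * real j * (real k - real i)"
  \<comment> \<open>\<open>N\<close> is a positive integer, hence at least 1, which makes
    \<open>inverse N\<close> an admissible weight in a convex combination with 0.\<close>
  have "2 * j * (k - i) \<ge> 1" using assms by simp
  then have "real (2 * j * (k - i)) \<ge> 1" by linarith
  then have N: "N \<ge> 1" using assms by (simp add: N_def of_nat_diff)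
  have "inverse N *\<^sub>R (kostka_ray i j k :: (real, 'r) vec \<times> _) + (1 - inverse N) *\<^sub>R 0 \<in> kostka_cone"
    unfolding kostka_cone_def
    by (intro convexD[OF convex_convex_hull] kostka_ray_mem_cone[OF assms, unfolded kostka_cone_def]
      zero_mem_kostka_cone[unfolded kostka_cone_def]) (use N in \<open>auto simp: field_simps\<close>)
  then show ?thesis
    using total_kostka_vertex[OF assms]
    by (simp add: mem_kostka_polytope) (simp add: kostka_vertex_def N_def)
qed

lemma kostka_vertex_gaps:
  assumes "i < j" "j < k" "k \<le> CARD('r)"
  defines "v \<equiv> kostka_vertex i j k :: (real ^ ('r::{finite,linorder})) \<times> (real, 'r) vec"
    and "N \<equiv> 2 * real j * (real k - real i)"
  shows "n \<in> {1..CARD('r)} \<Longrightarrow> gap (fst v) n = of_bool (n = j) * (real k - real i) / N"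
    and "n \<le> CARD('r) \<Longrightarrow>
      mu_gap v n = (of_bool (n = i) * (real k - real j) + of_bool (n = k) * (real j - real i)) / N"
proof -
  have fst_v: "fst v = inverse N *\<^sub>R (real k - real i) *\<^sub>R omega j"
    and snd_v: "snd v = inverse N *\<^sub>R
      ((real k - real j) *\<^sub>R omega i + (real j - real i) *\<^sub>R omega k)"
    by (simp_all add: v_def N_def kostka_vertex_def kostka_ray_def)
  show "gap (fst v) n = of_bool (n = j) * (real k - real i) / N" if "n \<in> {1..CARD('r)}"
    using assms(1-3) that unfolding fst_v
    by (simp only: linear_cmul[OF gap_linear]) (simp add: gap_omega divide_inverse)
  show "mu_gap v n = (of_bool (n = i) * (real k - real j) + of_bool (n = k) * (real j - real i)) / N"
    if "n \<le> CARD('r)"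
  proof (cases "n = 0")
    case True
    have 1: "1 \<in> {1..CARD('r)}" by (simp add: Suc_leI)
    have "mu_gap v n = inverse N * (real k - real i) * of_bool (1 \<le> j)
      - inverse N * ((real k - real j) * of_bool (1 \<le> i) + (real j - real i) * of_bool (1 \<le> k))"
      using assms(1-3) True unfolding mu_gap_def fst_v snd_v
      by (simp only: linear_cmul[OF coord_linear] linear_add[OF coord_linear])
        (simp add: coord_omega[OF 1, unfolded One_nat_def])
    \<comment> \<open>For i = 0 the weight \<open>omega i\<close> is zero and (k - i) - (j - i) = k
      - j remains; for i > 0 the three terms cancel.\<close>
    then show ?thesis using True assms(1,2) by (cases "i = 0") (auto simp: divide_inverse algebra_simps)
  next
    case False
    then have "mu_gap v n = inverse N *
        ((real k - real j) * of_bool (n = i) + (real j - real i) * of_bool (n = k))"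
      using assms(1-3) that unfolding mu_gap_def snd_v
      by (simp only: linear_cmul[OF gap_linear] linear_add[OF gap_linear]) (simp add: gap_omega)
    then show ?thesis by (simp add: divide_inverse algebra_simps)
  qed
qed

section \<open>Faces cut out by vanishing gaps\<close>

text \<open>A linear functional is the inner product with a fixed vector, so its zero set is a
  supporting hyperplane.\<close>

lemma face_of_zero_set:
  fixes f :: "'a::euclidean_space \<Rightarrow> real"
  assumes "linear f" "convex S" "\<And>x. x \<in> S \<Longrightarrow> f x \<ge> 0"
  shows "S \<inter> {x. f x = 0} face_of S"
proof -
  have "f x = adjoint f 1 \<bullet> x" for x
    using adjoint_works[OF assms(1), of x 1] by (simp add: inner_commute)
  then show ?thesis
    using face_of_Int_supporting_hyperplane_ge[OF assms(2), of 0 "adjoint f 1"] assms(3) by simp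
qed


lemma convex_kostka_polytope:
  "convex (kostka_polytope :: ((real, 'r::{finite,linorder}) vec \<times> (real, 'r) vec) set)"
proof -
  have "linear (\<lambda>x :: (real, 'r) vec \<times> (real, 'r) vec. vec_total (fst x) + vec_total (snd x))"
    by (rule linearI) (simp_all add: linear_add[OF total_linear] linear_cmul[OF total_linear] algebra_simps)
  then have "convex ((\<lambda>x :: (real, 'r) vec \<times> (real, 'r) vec. vec_total (fst x) + vec_total (snd x)) -` {1})"
    by (rule convex_linear_vimage) simp
  moreover have "kostka_polytope = (kostka_cone :: ((real, 'r) vec \<times> (real, 'r) vec) set) \<inter>
      (\<lambda>x. vec_total (fst x) + vec_total (snd x)) -` {1}"
    by (auto simp: mem_kostka_polytope)
  moreover have "convex (kostka_cone :: ((real, 'r) vec \<times> (real, 'r) vec) set)"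
    by (simp add: kostka_cone_def)
  ultimately show ?thesis by (metis convex_Int)
qed

text \<open>The sets hold the indices whose coefficients may be nonzero: \<open>J\<close> for
  \<lambda>, \<open>I\<close> and \<open>K\<close> for \<mu>. Putting 0 into \<open>I\<close> leaves
  the slack of the first dominance inequality free.\<close>

definition kostka_face ::
  "nat set \<Rightarrow> nat set \<Rightarrow> nat set \<Rightarrow> ((real, 'r::{finite,linorder}) vec \<times> (real, 'r) vec) set" where
  "kostka_face I J K = {x \<in> kostka_polytope.
     (\<forall>n\<in>{1..CARD('r)} - J. gap (fst x) n = 0) \<and> (\<forall>n\<in>{0..CARD('r)} - (I \<union> K). mu_gap x n = 0)}"

text \<open>On the polytope all the constrained quantities are nonnegative, so their sum is a single
  linear functional that vanishes exactly where each of them does.\<close>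

lemma kostka_face_face_of:
  "(kostka_face I J K :: ((real, 'r::{finite,linorder}) vec \<times> (real, 'r) vec) set) face_of kostka_polytope"
proof -
  define f :: "(real, 'r) vec \<times> (real, 'r) vec \<Rightarrow> real" where
    "f x = (\<Sum>n\<in>{1..CARD('r)} - J. gap (fst x) n) + (\<Sum>n\<in>{0..CARD('r)} - (I \<union> K). mu_gap x n)" for x
  have "linear f"
    unfolding f_def
    by (rule linearI) (simp_all add: linear_add[OF gap_linear] linear_cmul[OF gap_linear]
      linear_add[OF mu_gap_linear] linear_cmul[OF mu_gap_linear] sum.distrib sum_distrib_left algebra_simps)
  moreover have nonneg: "(\<Sum>n\<in>{1..CARD('r)} - J. gap (fst x) n) \<ge> 0"
    "(\<Sum>n\<in>{0..CARD('r)} - (I \<union> K). mu_gap x n) \<ge> 0"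
    "f x = 0 \<longleftrightarrow> (\<forall>n\<in>{1..CARD('r)} - J. gap (fst x) n = 0) \<and> (\<forall>n\<in>{0..CARD('r)} - (I \<union> K). mu_gap x n = 0)"
    if "x \<in> kostka_polytope" for x
  proof -
    have x: "x \<in> kostka_cone" using that by (simp add: mem_kostka_polytope)
    have 1: "gap (fst x) n \<ge> 0" if "n \<in> {1..CARD('r)} - J" for n
      using kostka_cone_inequalities(1)[OF x] that by blast
    have 2: "mu_gap x n \<ge> 0" if "n \<in> {0..CARD('r)} - (I \<union> K)" for n
      using kostka_cone_inequalities(2)[OF x] that by simp
    show s: "(\<Sum>n\<in>{1..CARD('r)} - J. gap (fst x) n) \<ge> 0"
      "(\<Sum>n\<in>{0..CARD('r)} - (I \<union> K). mu_gap x n) \<ge> 0"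
      by (intro sum_nonneg 1 2; assumption)+
    show "f x = 0 \<longleftrightarrow> (\<forall>n\<in>{1..CARD('r)} - J. gap (fst x) n = 0) \<and> (\<forall>n\<in>{0..CARD('r)} - (I \<union> K). mu_gap x n = 0)"
      unfolding f_def add_nonneg_eq_0_iff[OF s]
      by (simp only: sum_nonneg_eq_0_iff[OF _ 1] sum_nonneg_eq_0_iff[OF _ 2] finite_Diff finite_atLeastAtMost)
  qed
  moreover have "f x \<ge> 0" if "x \<in> kostka_polytope" for x
    unfolding f_def by (intro add_nonneg_nonneg nonneg that)
  ultimately have "kostka_polytope \<inter> {x. f x = 0} face_of kostka_polytope"
    by (intro face_of_zero_set convex_kostka_polytope)
  also have "kostka_polytope \<inter> {x. f x = 0} = kostka_face I J K"
    unfolding kostka_face_def using nonneg(3) by blast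
  finally show ?thesis .
qed

lemma kostka_face_expansion:
  fixes x :: "(real, 'r::{finite,linorder}) vec \<times> (real, 'r) vec"
  assumes "x \<in> kostka_face I J K" and J: "J \<subseteq> {1..CARD('r)}" and IK: "I \<union> K \<subseteq> {0..CARD('r)}"
  shows "fst x = (\<Sum>n\<in>J. gap (fst x) n *\<^sub>R omega n)"
    and "snd x = (\<Sum>n\<in>I \<union> K. mu_gap x n *\<^sub>R omega n)"
    and "(\<Sum>n\<in>J. gap (fst x) n) = (\<Sum>n\<in>I \<union> K. mu_gap x n)"
    and "(\<Sum>n\<in>J. gap (fst x) n * real n) = 1 / 2"
    and "(\<Sum>n\<in>I \<union> K. mu_gap x n * real n) = 1 / 2"
    and "n \<in> J \<Longrightarrow> gap (fst x) n \<ge> 0"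
    and "n \<in> I \<union> K \<Longrightarrow> mu_gap x n \<ge> 0"
proof -
  have cone: "x \<in> kostka_cone" and sum1: "vec_total (fst x) + vec_total (snd x) = 1"
    and gap0: "\<forall>n\<in>{1..CARD('r)} - J. gap (fst x) n = 0"
    and mu0: "\<And>n. n \<in> {0..CARD('r)} - (I \<union> K) \<Longrightarrow> mu_gap x n = 0"
    using assms(1) by (simp_all add: kostka_face_def mem_kostka_polytope)
  have half: "vec_total (fst x) = 1 / 2" "vec_total (snd x) = 1 / 2"
    using kostka_cone_inequalities(3)[OF cone] sum1 by simp_all
  have fin: "finite (I \<union> K)" using IK finite_subset by blast
  \<comment> \<open>Index 0 is split off because the expansion of \<mu> uses positive indices. Its
    term reappears with \<open>omega 0 = 0\<close> and affects only the plain sum of the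
    coefficients, which it raises from \<mu>_1 to \<lambda>_1.\<close>
  define S where "S = (I \<union> K) - {0}"
  have S: "S \<subseteq> {1..CARD('r)}" using IK by (force simp: S_def)
  have mu_S: "mu_gap x n = gap (snd x) n" if "n \<in> S" for n
    using that by (simp add: mu_gap_def S_def)
  have S0: "\<forall>n\<in>{1..CARD('r)} - S. gap (snd x) n = 0"
  proof
    fix n assume "n \<in> {1..CARD('r)} - S"
    then show "gap (snd x) n = 0" using mu0[of n] by (auto simp: mu_gap_def S_def)
  qed
  note eJ = omega_expansion_on[OF J gap0] and eS = omega_expansion_on[OF S S0]
  show "fst x = (\<Sum>n\<in>J. gap (fst x) n *\<^sub>R omega n)" by (rule eJ(1))
  have "(\<Sum>n\<in>I \<union> K. mu_gap x n *\<^sub>R (omega n :: (real, 'r) vec)) = (\<Sum>n\<in>S. gap (snd x) n *\<^sub>R omega n)"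
    using fin by (intro sum.mono_neutral_cong_right) (auto simp: S_def omega_0 mu_gap_def)
  then show "snd x = (\<Sum>n\<in>I \<union> K. mu_gap x n *\<^sub>R omega n)" using eS(1) by simp
  have "(\<Sum>n\<in>I \<union> K. mu_gap x n) = mu_gap x 0 + (\<Sum>n\<in>S. gap (snd x) n)"
  proof (cases "0 \<in> I \<union> K")
    case True
    have "sum (mu_gap x) S = sum (gap (snd x)) S" by (rule sum.cong[OF refl mu_S])
    then show ?thesis using sum.remove[OF fin True, of "mu_gap x"] by (simp add: S_def)
  next
    case False
    then have "mu_gap x 0 = 0" "S = I \<union> K" using mu0[of 0] by (auto simp: S_def)
    then show ?thesis using sum.cong[OF refl mu_S, of S] by simp
  qed
  also have "\<dots> = coord (fst x) 1" by (simp add: mu_gap_def flip: eS(2))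
  finally show "(\<Sum>n\<in>J. gap (fst x) n) = (\<Sum>n\<in>I \<union> K. mu_gap x n)" using eJ(2) by simp
  show "(\<Sum>n\<in>J. gap (fst x) n * real n) = 1 / 2" using eJ(3) half by simp
  have "(\<Sum>n\<in>I \<union> K. mu_gap x n * real n) = (\<Sum>n\<in>S. gap (snd x) n * real n)"
    using fin by (intro sum.mono_neutral_cong_right) (auto simp: S_def mu_gap_def)
  then show "(\<Sum>n\<in>I \<union> K. mu_gap x n * real n) = 1 / 2" using eS(3) half by simp
  show "n \<in> J \<Longrightarrow> gap (fst x) n \<ge> 0" using kostka_cone_inequalities(1)[OF cone] J by blast
  show "n \<in> I \<union> K \<Longrightarrow> mu_gap x n \<ge> 0" using kostka_cone_inequalities(2)[OF cone] IK by auto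
qed

section \<open>Decomposition of the face into vertices\<close>

lemma sum_triple_scaleR:
  fixes f g h :: "nat \<Rightarrow> real" and e :: "nat \<Rightarrow> 'v::real_vector"
  shows "(\<Sum>(i, j, k)\<in>I \<times> J \<times> K. (f i * g j * h k) *\<^sub>R e i) = (sum g J * sum h K) *\<^sub>R (\<Sum>i\<in>I. f i *\<^sub>R e i)"
    and "(\<Sum>(i, j, k)\<in>I \<times> J \<times> K. (f i * g j * h k) *\<^sub>R e j) = (sum f I * sum h K) *\<^sub>R (\<Sum>j\<in>J. g j *\<^sub>R e j)"
    and "(\<Sum>(i, j, k)\<in>I \<times> J \<times> K. (f i * g j * h k) *\<^sub>R e k) = (sum f I * sum g J) *\<^sub>R (\<Sum>k\<in>K. h k *\<^sub>R e k)"
proof -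
  show "(\<Sum>(i, j, k)\<in>I \<times> J \<times> K. (f i * g j * h k) *\<^sub>R e i) = (sum g J * sum h K) *\<^sub>R (\<Sum>i\<in>I. f i *\<^sub>R e i)"
    by (simp add: sum.cartesian_product' scaleR_sum_right mult.commute[of _ "f _"] mult.assoc
      flip: scaleR_sum_left sum_distrib_left sum_distrib_right)
  have "(\<Sum>(i, j, k)\<in>I \<times> J \<times> K. (f i * g j * h k) *\<^sub>R e j) = (\<Sum>i\<in>I. f i *\<^sub>R sum h K *\<^sub>R (\<Sum>j\<in>J. g j *\<^sub>R e j))"
    by (simp add: sum.cartesian_product' scaleR_sum_right mult_ac
      flip: scaleR_sum_left sum_distrib_left sum_distrib_right)
  then show "(\<Sum>(i, j, k)\<in>I \<times> J \<times> K. (f i * g j * h k) *\<^sub>R e j) = (sum f I * sum h K) *\<^sub>R (\<Sum>j\<in>J. g j *\<^sub>R e j)"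
    by (simp add: sum_distrib_right flip: scaleR_sum_left)
  have "(\<Sum>(i, j, k)\<in>I \<times> J \<times> K. (f i * g j * h k) *\<^sub>R e k) = (\<Sum>i\<in>I. \<Sum>j\<in>J. (f i * g j) *\<^sub>R (\<Sum>k\<in>K. h k *\<^sub>R e k))"
    by (simp add: sum.cartesian_product' scaleR_sum_right)
  then show "(\<Sum>(i, j, k)\<in>I \<times> J \<times> K. (f i * g j * h k) *\<^sub>R e k) = (sum f I * sum g J) *\<^sub>R (\<Sum>k\<in>K. h k *\<^sub>R e k)"
    by (simp add: sum_product flip: scaleR_sum_left)
qed

text \<open>Each coefficient of a ray is a difference of two indices, so every triple sum factors
  into single sums. The scalar left in front of the \<lambda> part and of both \<mu> parts is the
  same \<open>D\<close>.\<close>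

lemma sum_kostka_ray:
  fixes a b c :: "nat \<Rightarrow> real"
  assumes A: "sum a J = sum b I + sum c K"
    and T: "(\<Sum>j\<in>J. a j * real j) = (\<Sum>i\<in>I. b i * real i) + (\<Sum>k\<in>K. c k * real k)"
  defines "D \<equiv> sum b I * (\<Sum>k\<in>K. c k * real k) - (\<Sum>i\<in>I. b i * real i) * sum c K"
  shows "(\<Sum>(i, j, k)\<in>I \<times> J \<times> K. (b i * a j * c k) *\<^sub>R (kostka_ray i j k :: (real, 'r::{finite,linorder}) vec \<times> _))
    = D *\<^sub>R (\<Sum>j\<in>J. a j *\<^sub>R omega j, (\<Sum>i\<in>I. b i *\<^sub>R omega i) + (\<Sum>k\<in>K. c k *\<^sub>R omega k))"
    (is "?L = ?R")
proof (rule prod_eqI)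
  let ?p = "\<Sum>i\<in>I. b i * real i" and ?q = "\<Sum>k\<in>K. c k * real k"
  let ?X = "I \<times> J \<times> K"
  \<comment> \<open>\<open>D\<close> is the determinant with rows (sum of b, sum of i b) and (sum of
    c, sum of k c). By \<open>A\<close> and \<open>T\<close> the corresponding row for a is the sum
    of these two, and replacing either row by it leaves the determinant unchanged.\<close>
  have D2: "D = sum a J * ?q - (\<Sum>j\<in>J. a j * real j) * sum c K"
    "D = sum b I * (\<Sum>j\<in>J. a j * real j) - ?p * sum a J"
    unfolding D_def A T by (simp_all add: algebra_simps)
  have "fst ?L = (\<Sum>(i, j, k)\<in>?X. (b i * a j * (c k * real k)) *\<^sub>R omega j)
      - (\<Sum>(i, j, k)\<in>?X. ((b i * real i) * a j * c k) *\<^sub>R omega j)"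
    unfolding fst_sum sum_subtractf[symmetric]
    by (intro sum.cong) (auto simp: kostka_ray_def algebra_simps)
  then show "fst ?L = fst ?R"
    unfolding sum_triple_scaleR by (simp add: D_def algebra_simps)
  have "snd ?L = (\<Sum>(i, j, k)\<in>?X. (b i * a j * (c k * real k)) *\<^sub>R omega i)
      - (\<Sum>(i, j, k)\<in>?X. (b i * (a j * real j) * c k) *\<^sub>R omega i)
      + ((\<Sum>(i, j, k)\<in>?X. (b i * (a j * real j) * c k) *\<^sub>R omega k)
      - (\<Sum>(i, j, k)\<in>?X. ((b i * real i) * a j * c k) *\<^sub>R omega k))"
    unfolding snd_sum sum_subtractf[symmetric] sum.distrib[symmetric]
    by (intro sum.cong) (auto simp: kostka_ray_def algebra_simps)
  also have "\<dots> = D *\<^sub>R (\<Sum>i\<in>I. b i *\<^sub>R omega i) + D *\<^sub>R (\<Sum>k\<in>K. c k *\<^sub>R omega k)"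
    unfolding sum_triple_scaleR scaleR_left_diff_distrib[symmetric] D2[symmetric] ..
  finally show "snd ?L = snd ?R" by (simp add: scaleR_add_right)
qed

lemma double_sum_nonneg_0:
  fixes g :: "nat \<Rightarrow> nat \<Rightarrow> real"
  assumes "(\<Sum>j\<in>J. \<Sum>k\<in>S. g j k) = 0" "finite J" "finite S"
    and nn: "\<And>j k. j \<in> J \<Longrightarrow> k \<in> S \<Longrightarrow> g j k \<ge> 0"
    and "j \<in> J" "k \<in> S"
  shows "g j k = 0"
proof -
  have "(\<Sum>k\<in>S. g j k) = 0"
    by (rule sum_nonneg_0[OF assms(2) _ assms(1,5)]) (intro sum_nonneg nn)
  from sum_nonneg_0[OF assms(3) _ this assms(6)] nn[OF assms(5)] show ?thesis by blast
qed

text \<open>The vertices satisfy the defining equations of the face. Conversely, the weighted sum of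
  rays reproduces D times a given point, so what remains is that D is positive and that the
  normalised weights sum to 1.\<close>

lemma kostka_face_eq_hull:
  assumes ord: "\<forall>i\<in>I. \<forall>j\<in>J. i < j" "\<forall>j\<in>J. \<forall>k\<in>K. j < k"
    and bounds: "I \<subseteq> {0..CARD('r)}" "J \<subseteq> {1..CARD('r)}" "K \<subseteq> {0..CARD('r)}"
  shows "(kostka_face I J K :: ((real, 'r::{finite,linorder}) vec \<times> (real, 'r) vec) set)
    = convex hull ((\<lambda>(i, j, k). kostka_vertex i j k) ` (I \<times> J \<times> K))"
    (is "_ = convex hull ?V")
proof
  have fin: "finite I" "finite J" "finite K" using bounds finite_subset by blast+
  show "convex hull ?V \<subseteq> kostka_face I J K"
  proof (rule hull_minimal)
    show "convex (kostka_face I J K :: ((real, 'r) vec \<times> (real, 'r) vec) set)"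
      using kostka_face_face_of face_of_imp_convex by blast
    show "?V \<subseteq> kostka_face I J K"
    proof
      fix y :: "(real, 'r) vec \<times> (real, 'r) vec"
      assume "y \<in> ?V"
      then obtain i j k where ijk: "i \<in> I" "j \<in> J" "k \<in> K" and y: "y = kostka_vertex i j k" by auto
      then have lt: "i < j" "j < k" "k \<le> CARD('r)" using ord bounds by auto
      show "y \<in> kostka_face I J K"
        using kostka_vertex_mem_polytope[OF lt] kostka_vertex_gaps[OF lt] ijk
        by (auto simp: kostka_face_def y)
    qed
  qed
  show "kostka_face I J K \<subseteq> convex hull ?V"
  proof
    fix x :: "(real, 'r) vec \<times> (real, 'r) vec"
    assume x: "x \<in> kostka_face I J K"
    define a b where "a = gap (fst x)" and "b = mu_gap x"
    note e = kostka_face_expansion[OF x bounds(2) Un_least[OF bounds(1,3)], folded a_def b_def]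
    \<comment> \<open>The weighted sum over \<open>J\<close> is 1/2, so \<open>J\<close> has an
      element; a common element of \<open>I\<close> and \<open>K\<close> would lie both below and
      above it.\<close>
    have "J \<noteq> {}" using e(4) by auto
    then have disj: "I \<inter> K = {}" using ord by fastforce
    note un = sum.union_disjoint[OF fin(1,3) disj]
    have A: "sum a J = sum b I + sum b K" using e(3) un by metis
    have T: "(\<Sum>j\<in>J. a j * real j) = (\<Sum>i\<in>I. b i * real i) + (\<Sum>k\<in>K. b k * real k)"
      using e(4,5) un by metis
    define D where "D = sum b I * (\<Sum>k\<in>K. b k * real k) - (\<Sum>i\<in>I. b i * real i) * sum b K"
    \<comment> \<open>In the forms with one row replaced by the row for a, the order of the index
      sets makes every summand nonnegative.\<close>
    have D1: "D = (\<Sum>j\<in>J. \<Sum>k\<in>K. a j * b k * (real k - real j))"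
    proof -
      have "D = sum a J * (\<Sum>k\<in>K. b k * real k) - (\<Sum>j\<in>J. a j * real j) * sum b K"
        unfolding D_def A T by (simp add: algebra_simps)
      then show ?thesis
        unfolding sum_product sum_subtractf[symmetric] by (simp add: algebra_simps)
    qed
    have D2: "D = (\<Sum>j\<in>J. \<Sum>i\<in>I. a j * b i * (real j - real i))"
    proof -
      have "D = (\<Sum>j\<in>J. a j * real j) * sum b I - sum a J * (\<Sum>i\<in>I. b i * real i)"
        unfolding D_def A T by (simp add: algebra_simps)
      then show ?thesis
        unfolding sum_product sum_subtractf[symmetric] by (simp add: algebra_simps)
    qed
    have nn1: "a j * b k * (real k - real j) \<ge> 0" if "j \<in> J" "k \<in> K" for j k
      using e(6)[of j] e(7)[of k] ord(2) that by (auto intro!: mult_nonneg_nonneg simp: less_imp_le)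
    have nn2: "a j * b i * (real j - real i) \<ge> 0" if "j \<in> J" "i \<in> I" for j i
      using e(6)[of j] e(7)[of i] ord(1) that by (auto intro!: mult_nonneg_nonneg simp: less_imp_le)
    \<comment> \<open>If \<open>D\<close> were 0, all summands of both forms would vanish. At an
      index j with nonzero \<open>a j\<close> this kills every coefficient of \<mu>, and then the
      balance equation kills \<open>a j\<close> as well.\<close>
    have "D \<noteq> 0"
    proof
      assume "D = 0"
      obtain j where j: "j \<in> J" "a j \<noteq> 0"
        using e(4) by (metis (no_types, lifting) sum.neutral mult_zero_left zero_neq_one divide_eq_0_iff zero_neq_numeral)
      have "b k = 0" if "k \<in> K" for k
        using double_sum_nonneg_0[OF D1[symmetric, unfolded \<open>D = 0\<close>] fin(2,3) nn1 j(1) that] j ord(2) that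
        by auto
      moreover have "b i = 0" if "i \<in> I" for i
        using double_sum_nonneg_0[OF D2[symmetric, unfolded \<open>D = 0\<close>] fin(2,1) nn2 j(1) that] j ord(1) that
        by auto
      ultimately have "sum a J = 0" using A by simp
      from sum_nonneg_0[OF fin(2) _ this j(1)] e(6) j(2) show False by blast
    qed
    moreover have "D \<ge> 0" unfolding D1 using nn1 by (auto intro!: sum_nonneg)
    ultimately have D: "D > 0" by simp
    \<comment> \<open>The factor 2 j (k - i) undoes the normalisation of the vertex.\<close>
    define u where "u = (\<lambda>(i, j, k). b i * a j * b k * (2 * real j * (real k - real i)) / D)"
    let ?v = "\<lambda>(i, j, k). kostka_vertex i j k :: (real, 'r) vec \<times> (real, 'r) vec"
    let ?X = "I \<times> J \<times> K"
    have u: "u t \<ge> 0" "u t *\<^sub>R ?v t = (case t of (i, j, k) \<Rightarrow> inverse D *\<^sub>R (b i * a j * b k) *\<^sub>R kostka_ray i j k)"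
      "vec_total (fst (?v t)) = 1 / 2" if "t \<in> ?X" for t
    proof -
      obtain i j k where t: "t = (i, j, k)" by (metis prod_cases3)
      with that have ijk: "i \<in> I" "j \<in> J" "k \<in> K" by auto
      then have lt: "i < j" "j < k" "k \<le> CARD('r)" using ord bounds by auto
      show "u t \<ge> 0" using lt D e(6)[of j] e(7)[of i] e(7)[of k] ijk by (auto simp: u_def t)
      show "vec_total (fst (?v t)) = 1 / 2" using total_kostka_vertex(1)[OF lt] by (simp add: t)
      show "u t *\<^sub>R ?v t = (case t of (i, j, k) \<Rightarrow> inverse D *\<^sub>R (b i * a j * b k) *\<^sub>R kostka_ray i j k)"
      proof -
        define N where "N = 2 * real j * (real k - real i)"
        have "N \<noteq> 0" using lt by (simp add: N_def)
        then have "(b i * a j * b k * N / D) * inverse N = inverse D * (b i * a j * b k)"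
          by (simp add: field_simps)
        then show ?thesis by (simp only: t u_def kostka_vertex_def prod.case scaleR_scaleR N_def[symmetric])
      qed
    qed
    have "(\<Sum>t\<in>?X. u t *\<^sub>R ?v t) =
        inverse D *\<^sub>R (\<Sum>(i, j, k)\<in>?X. (b i * a j * b k) *\<^sub>R kostka_ray i j k)"
      unfolding scaleR_sum_right by (rule sum.cong[OF refl]) (use u(2) in auto)
    also have "\<dots> = inverse D *\<^sub>R D *\<^sub>R
        (\<Sum>j\<in>J. a j *\<^sub>R omega j, (\<Sum>i\<in>I. b i *\<^sub>R omega i) + (\<Sum>k\<in>K. b k *\<^sub>R omega k))"
      unfolding sum_kostka_ray[OF A T] D_def ..
    also have "\<dots> = (fst x, snd x)"
      using D e(1,2) un[of "\<lambda>n. b n *\<^sub>R (omega n :: (real, 'r) vec)"] by simp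
    finally have x_eq: "(\<Sum>t\<in>?X. u t *\<^sub>R ?v t) = x" by simp
    have "x \<in> kostka_cone" "vec_total (fst x) + vec_total (snd x) = 1"
      using x by (simp_all add: kostka_face_def mem_kostka_polytope)
    \<comment> \<open>The weights sum to 1 because the total of the first component is 1/2 both at x
      and at every vertex.\<close>
    then have "1 / 2 = vec_total (fst x)" using kostka_cone_inequalities(3) by fastforce
    also have "\<dots> = (\<Sum>t\<in>?X. u t * vec_total (fst (?v t)))"
      unfolding x_eq[symmetric]
      by (simp only: fst_sum linear_sum[OF total_linear] linear_cmul[OF total_linear] fst_scaleR real_scaleR_def)
    also have "\<dots> = sum u ?X / 2"
      unfolding sum_divide_distrib by (rule sum.cong[OF refl], subst u(3)) simp_all
    finally have "sum u ?X = 1" by simp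
    then have "(\<Sum>t\<in>?X. u t *\<^sub>R ?v t) \<in> convex hull ?V"
      using fin u(1) by (intro convex_sum convex_convex_hull hull_inc imageI) (simp_all only: finite_cartesian_product)
    then show "x \<in> convex hull ?V" using x_eq by simp
  qed
qed

section \<open>Extreme points\<close>

text \<open>The open half-space on which the sum of the coefficients off the support of t is
  positive contains all other vertices, hence their hull, but not \<open>v t\<close>.\<close>

lemma kostka_vertices_convex_independent:
  assumes ord: "\<forall>i\<in>I. \<forall>j\<in>J. i < j" "\<forall>j\<in>J. \<forall>k\<in>K. j < k"
    and bounds: "I \<subseteq> {0..CARD('r)}" "J \<subseteq> {1..CARD('r)}" "K \<subseteq> {0..CARD('r)}"
  defines "v \<equiv> (\<lambda>(i, j, k). kostka_vertex i j k :: (real, 'r::{finite,linorder}) vec \<times> (real, 'r) vec)"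
  assumes t: "t \<in> I \<times> J \<times> K"
  shows "v t \<notin> convex hull (v ` (I \<times> J \<times> K - {t}))"
proof -
  have fin: "finite I" "finite J" "finite K" using bounds finite_subset by blast+
  obtain i j k where t_eq: "t = (i, j, k)" by (metis prod_cases3)
  with t have ijk: "i \<in> I" "j \<in> J" "k \<in> K" by auto
  have lt: "p < q" "q < s" "s \<le> CARD('r)" "p \<le> CARD('r)" "q \<in> {1..CARD('r)}"
    if "p \<in> I" "q \<in> J" "s \<in> K" for p q s
    using ord that bounds by auto
  define f :: "(real, 'r) vec \<times> (real, 'r) vec \<Rightarrow> real" where
    "f x = (\<Sum>n\<in>J - {j}. gap (fst x) n) + (\<Sum>n\<in>(I \<union> K) - {i, k}. mu_gap x n)" for x
  have "linear f"
    unfolding f_def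
    by (rule linearI) (simp_all add: linear_add[OF gap_linear] linear_cmul[OF gap_linear]
      linear_add[OF mu_gap_linear] linear_cmul[OF mu_gap_linear] sum.distrib sum_distrib_left algebra_simps)
  then have "convex (f -` {0<..})" by (rule convex_linear_vimage) simp
  moreover have "f (v t') > 0" if "t' \<in> I \<times> J \<times> K - {t}" for t'
  proof -
    obtain p q s where t': "t' = (p, q, s)" by (metis prod_cases3)
    with that have pqs: "p \<in> I" "q \<in> J" "s \<in> K" and ne: "p \<noteq> i \<or> q \<noteq> j \<or> s \<noteq> k"
      by (auto simp: t_eq)
    note l = lt[OF pqs]
    define N where "N = 2 * real q * (real s - real p)"
    have N: "N > 0" using l by (simp add: N_def)
    have g: "gap (fst (v t')) n = of_bool (n = q) * (real s - real p) / N" if "n \<in> J" for n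
      using kostka_vertex_gaps(1)[OF l(1-3), of n] bounds that by (auto simp: v_def t' N_def)
    have m: "mu_gap (v t') n = (of_bool (n = p) * (real s - real q) + of_bool (n = s) * (real q - real p)) / N"
      if "n \<in> I \<union> K" for n
      using kostka_vertex_gaps(2)[OF l(1-3), of n] bounds that by (auto simp: v_def t' N_def)
    have g0: "gap (fst (v t')) n \<ge> 0" if "n \<in> J" for n using g[OF that] l N by simp
    have m0: "mu_gap (v t') n \<ge> 0" if "n \<in> I \<union> K" for n using m[OF that] l N by simp
    have s0: "(\<Sum>n\<in>J - {j}. gap (fst (v t')) n) \<ge> 0" "(\<Sum>n\<in>(I \<union> K) - {i, k}. mu_gap (v t') n) \<ge> 0"
      using g0 m0 by (auto intro!: sum_nonneg)
    show ?thesis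
    proof (cases "q = j")
      case False
      have "(\<Sum>n\<in>J - {j}. gap (fst (v t')) n) > 0"
        by (rule sum_pos2[of _ q]) (use fin pqs False g g0 l N in auto)
      with s0 show ?thesis by (simp add: f_def)
    next
      case True
      with ne consider "p \<noteq> i" | "s \<noteq> k" by auto
      then have "(\<Sum>n\<in>(I \<union> K) - {i, k}. mu_gap (v t') n) > 0"
      proof cases
        case 1
        \<comment> \<open>The sum omits both i and k, so p must differ from k too in order to
          contribute; the order of the index sets ensures this.\<close>
        have "p \<noteq> k" using lt[OF pqs(1,2) ijk(3)] by auto
        with 1 show ?thesis
          by (intro sum_pos2[of _ p]) (use fin pqs m m0 l N in auto)
      next
        case 2
        have "s \<noteq> i" using lt[OF ijk(1) pqs(2,3)] by auto
        with 2 show ?thesis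
          by (intro sum_pos2[of _ s]) (use fin pqs m m0 l N in auto)
      qed
      with s0 show ?thesis by (simp add: f_def)
    qed
  qed
  ultimately have "convex hull (v ` (I \<times> J \<times> K - {t})) \<subseteq> f -` {0<..}"
    by (intro hull_minimal) auto
  moreover have "f (v t) = 0"
  proof -
    note l = lt[OF ijk]
    have "gap (fst (v t)) n = 0" if "n \<in> J - {j}" for n
      using kostka_vertex_gaps(1)[OF l(1-3), of n] bounds that by (auto simp: v_def t_eq)
    moreover have "mu_gap (v t) n = 0" if "n \<in> (I \<union> K) - {i, k}" for n
      using kostka_vertex_gaps(2)[OF l(1-3), of n] bounds that by (auto simp: v_def t_eq)
    ultimately show ?thesis by (simp add: f_def)
  qed
  ultimately show ?thesis by auto
qed

text \<open>The extreme points of the hull of a finite convexly independent set are exactly its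
  members. Independence also makes \<open>v\<close> injective, since \<open>v s = v t\<close> would
  place \<open>v t\<close> in the hull of the others.\<close>

lemma kostka_face_extreme_points:
  assumes ord: "\<forall>i\<in>I. \<forall>j\<in>J. i < j" "\<forall>j\<in>J. \<forall>k\<in>K. j < k"
    and bounds: "I \<subseteq> {0..CARD('r)}" "J \<subseteq> {1..CARD('r)}" "K \<subseteq> {0..CARD('r)}"
  defines "E \<equiv> {x. x extreme_point_of (kostka_face I J K :: ((real, 'r::{finite,linorder}) vec \<times> (real, 'r) vec) set)}"
  shows "finite E" "card E = card I * card J * card K"
proof -
  define v where "v = (\<lambda>(i, j, k). kostka_vertex i j k :: (real, 'r) vec \<times> (real, 'r) vec)"
  let ?X = "I \<times> J \<times> K"
  have fin: "finite ?X" using bounds finite_subset by blast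
  note indep = kostka_vertices_convex_independent[OF ord bounds, folded v_def]
  have inj: "inj_on v ?X"
  proof (rule inj_onI, rule ccontr)
    fix s t assume st: "s \<in> ?X" "t \<in> ?X" "v s = v t" "s \<noteq> t"
    then have "v t \<in> convex hull (v ` (?X - {t}))" by (metis DiffI hull_inc imageI singletonD)
    with indep st show False by blast
  qed
  have "a \<notin> convex hull (v ` ?X - {a})" if "a \<in> v ` ?X" for a
  proof -
    from that obtain t where t: "t \<in> ?X" "a = v t" by blast
    have "v ` ?X - {a} = v ` (?X - {t})"
      using inj_on_image_set_diff[OF inj, of ?X "{t}"] t by auto
    with indep[OF t(1)] t show ?thesis by simp
  qed
  then have "E = v ` ?X"
    unfolding E_def kostka_face_eq_hull[OF ord bounds] v_def[symmetric]
    using extreme_point_of_convex_hull_convex_independent[OF finite_imp_compact[OF finite_imageI[OF fin]]]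
    by blast
  then show "finite E" "card E = card I * card J * card K"
    using fin by (simp_all add: card_image[OF inj] card_cartesian_product)
qed

section \<open>Dimension bound\<close>

text \<open>The two balance equations allow every \<open>omega n\<close> to be corrected by a
  combination of \<open>omega p\<close> and \<open>omega q\<close> without changing the point. The
  corrected vectors at p and q are zero, so the face lies in a span of card I + card J + card K - 2
  vectors; it misses the origin affinely, which saves one more dimension.\<close>

lemma aff_dim_kostka_face_le:
  assumes bounds: "I \<subseteq> {0..CARD('r)}" "J \<subseteq> {1..CARD('r)}" "K \<subseteq> {0..CARD('r)}"
    and p: "p \<in> I" and q: "q \<in> K" and disj: "I \<inter> K = {}"
  shows "aff_dim (kostka_face I J K :: ((real, 'r::{finite,linorder}) vec \<times> (real, 'r) vec) set)
    \<le> int (card I) + int (card J) + int (card K) - 3"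
proof -
  let ?F = "kostka_face I J K :: ((real, 'r) vec \<times> (real, 'r) vec) set"
  have fin: "finite I" "finite J" "finite K" using bounds finite_subset by blast+
  have pq: "real q - real p \<noteq> 0" using p q disj by auto
  \<comment> \<open>\<open>line n\<close> interpolates linearly in n between \<open>omega p\<close>
    at p and \<open>omega q\<close> at q. Its weighted sums therefore depend only on the two
    quantities that the balance equations equate.\<close>
  define line :: "nat \<Rightarrow> (real, 'r) vec" where
    "line n = inverse (real q - real p) *\<^sub>R ((real q - real n) *\<^sub>R omega p + (real n - real p) *\<^sub>R omega q)" for n
  define A where "A j = (omega j :: (real, 'r) vec, line j)" for j
  define B where "B n = (0 :: (real, 'r) vec, omega n - line n)" for n
  let ?S = "A ` J \<union> B ` (I \<union> K - {p, q})"
  have B0: "B p = 0" "B q = 0" using pq by (simp_all add: B_def line_def zero_prod_def)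
  have line_sum: "(\<Sum>n\<in>S. c n *\<^sub>R line n) = inverse (real q - real p) *\<^sub>R
      ((real q * sum c S - (\<Sum>n\<in>S. c n * real n)) *\<^sub>R omega p
      + ((\<Sum>n\<in>S. c n * real n) - real p * sum c S) *\<^sub>R omega q)" for c and S :: "nat set"
  proof -
    have "(\<Sum>n\<in>S. c n *\<^sub>R line n) = inverse (real q - real p) *\<^sub>R
        (\<Sum>n\<in>S. (real q * c n - c n * real n) *\<^sub>R omega p + (c n * real n - real p * c n) *\<^sub>R omega q)"
      unfolding scaleR_sum_right line_def by (rule sum.cong[OF refl]) (simp add: algebra_simps)
    then show ?thesis
      by (simp add: sum.distrib sum_subtractf sum_distrib_left flip: scaleR_sum_left)
  qed
  have "?F \<subseteq> span ?S"
  proof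
    fix x assume x: "x \<in> ?F"
    note e = kostka_face_expansion[OF x bounds(2) Un_least[OF bounds(1,3)]]
    have "(\<Sum>n\<in>J. gap (fst x) n *\<^sub>R line n) = (\<Sum>n\<in>I \<union> K. mu_gap x n *\<^sub>R line n)"
      unfolding line_sum e(3-5) ..
    then have "x = (\<Sum>n\<in>J. gap (fst x) n *\<^sub>R A n) + (\<Sum>n\<in>I \<union> K. mu_gap x n *\<^sub>R B n)"
      using e(1,2) by (intro prod_eqI)
        (simp_all add: A_def B_def fst_sum snd_sum scaleR_diff_right sum_subtractf)
    moreover have "A n \<in> span ?S" if "n \<in> J" for n using that by (auto intro: span_base)
    moreover have "B n \<in> span ?S" if "n \<in> I \<union> K" for n
      using that B0 by (cases "n \<in> {p, q}") (auto intro: span_base span_zero)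
    ultimately show "x \<in> span ?S"
      by (metis (no_types, lifting) span_add span_scale span_sum)
  qed
  then have sub: "insert 0 ?F \<subseteq> span ?S" by (auto simp: span_zero)
  \<comment> \<open>All coordinates sum to 1 on the face and to 0 at the origin, so adjoining the
    origin raises the dimension by one.\<close>
  have "0 \<notin> affine hull ?F"
  proof
    define g where "g x = vec_total (fst x) + vec_total (snd x)" for x :: "(real, 'r) vec \<times> (real, 'r) vec"
    have lin: "linear g"
      unfolding g_def by (rule linearI) (simp_all add: linear_add[OF total_linear] linear_cmul[OF total_linear] algebra_simps)
    have "affine (g -` {1})"
      unfolding affine_def by (simp add: linear_add[OF lin] linear_cmul[OF lin])
    then have "affine hull ?F \<subseteq> g -` {1}"
      by (intro hull_minimal) (auto simp: kostka_face_def mem_kostka_polytope g_def)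
    moreover assume "0 \<in> affine hull ?F"
    ultimately show False using linear_0[OF lin] by auto
  qed
  then have "aff_dim ?F + 1 = aff_dim (insert 0 ?F)" by (simp add: aff_dim_insert)
  also have "\<dots> \<le> aff_dim (span ?S)" by (rule aff_dim_subset[OF sub])
  also have "\<dots> = int (dim ?S)" by (simp add: aff_dim_subspace subspace_span)
  also have "dim ?S \<le> card ?S" using fin by (intro dim_le_card') auto
  also have "card ?S \<le> card J + card (I \<union> K - {p, q})"
    using fin by (intro order_trans[OF card_Un_le] add_mono card_image_le) auto
  also have "card (I \<union> K - {p, q}) = card I + card K - 2"
    using fin p q disj pq by (subst card_Diff_subset) (auto simp: card_Un_disjoint)
  finally have "aff_dim ?F + 1 \<le> int (card J + (card I + card K - 2))" by simp
  moreover have "card I \<ge> 1" "card K \<ge> 1"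
    using fin p q by (auto simp: Suc_le_eq card_gt_0_iff)
  ultimately show ?thesis by simp
qed

section \<open>The face of the given hyperplanes\<close>

theorem theorem3p7:
  fixes d r z1 z2 z3 :: nat
    and F :: "((real ^ ('r::{finite,linorder})) \<times> (real ^ ('r::{finite,linorder}))) set"
  assumes "CARD('r) = r"
    and "r > d + 1"
    and "z1 > 0" and "z2 > 0" and "z3 > 0"
    and "z1 + z2 + z3 = d + 3"
    and "F = kostka_polytope
             \<inter> (\<Inter>i\<in>{1..z1 - 1}. H i)
             \<inter> (\<Inter>j\<in>{z1 + z2..r}. H j)
             \<inter> (\<Inter>k\<in>{z1..r - z3}. H_hat k)"
  shows "F face_of (kostka_polytope :: ((real ^ ('r::{finite,linorder})) \<times> (real ^ ('r::{finite,linorder}))) set)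
    \<and> aff_dim F \<le> int d
    \<and> finite {v. v extreme_point_of F}
    \<and> card {v. v extreme_point_of F} = z1 * z2 * z3"
proof -
  \<comment> \<open>The complements of \<open>J\<close> and of \<open>I \<union> K\<close> are the
    indices of the hyperplanes. \<open>I\<close> starts at 0, which belongs to the slack \<lambda>_1
    - \<mu>_1.\<close>
  define I J K where "I = {0..<z1}" and "J = {z1..<z1 + z2}" and "K = {r - z3 + 1..r}"
  \<comment> \<open>This bound places \<open>J\<close> below \<open>K\<close> and keeps
    \<open>r - z3\<close> from being truncated.\<close>
  have r: "z1 + z2 + z3 \<le> r + 1" using assms(2,6) by simp
  have H_gap: "x \<in> H n \<longleftrightarrow> gap (fst x) n = 0" if "n \<in> {1..r}" for x :: "(real, 'r) vec \<times> (real, 'r) vec" and n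
    using that assms(1) by (cases x) (auto simp: H_def gap_def)
  have H_hat_gap: "x \<in> H_hat n \<longleftrightarrow> mu_gap x n = 0" if "n \<in> {z1..r - z3}"
    for x :: "(real, 'r) vec \<times> (real, 'r) vec" and n
    using that assms(1,3,5) r by (cases x) (auto simp: H_hat_def mu_gap_def gap_def)
  have J': "{1..r} - J = {1..z1 - 1} \<union> {z1 + z2..r}" 
    using assms(3-5) r by (auto simp: J_def)
  have IK': "{0..r} - (I \<union> K) = {z1..r - z3}"
    using assms(3-5) r by (auto simp: I_def K_def)
  have sub: "{1..z1 - 1} \<union> {z1 + z2..r} \<subseteq> {1..r}" using J' by blast
  have F: "F = kostka_face I J K"
    unfolding kostka_face_def assms(1) J' IK' assms(7)
    using sub H_gap H_hat_gap by (auto simp only: Int_iff INT_iff mem_Collect_eq Un_iff) blast+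
  have ord: "\<forall>i\<in>I. \<forall>j\<in>J. i < j" "\<forall>j\<in>J. \<forall>k\<in>K. j < k"
    and bounds: "I \<subseteq> {0..CARD('r)}" "J \<subseteq> {1..CARD('r)}" "K \<subseteq> {0..CARD('r)}"
    using r assms(1,3-5) by (auto simp: I_def J_def K_def)
  have card: "card I = z1" "card J = z2" "card K = z3"
    using r assms(3-5) by (auto simp: I_def J_def K_def)
  have "0 \<in> I" "r \<in> K" "I \<inter> K = {}"
    using assms(3-5) r by (auto simp: I_def K_def)
  from aff_dim_kostka_face_le[OF bounds this] have "aff_dim F \<le> int d"
    unfolding F card using assms(6) by simp
  then show ?thesis
    using kostka_face_face_of[of I J K, where 'r = 'r] kostka_face_extreme_points[OF ord bounds] F card by simp
qed

end
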